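(* The class of groups (up to isomorphism) arising as automorphism groups of countable graphs is precisely the same as the class of groups arising as automorphism groups of countable bipartite graphs.
   Context: A graph is a pair $(V,E)$ with $E$ an irreflexive symmetric binary relation on $V$. A bipartite graph is a relational structure $(V,E,P)$ where $E$ is an irreflexive symmetric binary relation on $V$, $P=(V_0\times V_0)\cup(V_1\times V_1)$ for some partition $V=V_0\,\dot\cup\,V_1$, and $(u,v)\in E$ implies $(u,v)\notin P$. An automorphism of a bipartite graph is a bijection $f$ of $V$ such that $f$ and $f^{-1}$ preserve both $E$ and $P$ (so automorphisms may interchange the two parts). *)

theory Defs
  imports "HOL-Algebra.Bij" "HOL-Library.Countable_Set"
begin

text \<open>
  Vertices are drawn from a type \<open>'v\<close>, the vertex set \<open>V\<close> being any subset. When \<open>'v\<close> is infinite,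
  every countable (finite or countably infinite) structure has an isomorphic copy on a subset
  of \<open>'v\<close>, so quantifying over structures on \<open>'v\<close> covers all of them up to isomorphism.
\<close>

definition is_graph :: "'v set \<Rightarrow> ('v \<times> 'v) set \<Rightarrow> bool" where
  "is_graph V E \<longleftrightarrow> E \<subseteq> V \<times> V \<and> irrefl E \<and> sym E"

text \<open>As with any disjoint union, either of the parts \<open>V0\<close> and \<open>V1\<close> may be empty.\<close>

definition is_bipartite_graph ::
    "'v set \<Rightarrow> ('v \<times> 'v) set \<Rightarrow> ('v \<times> 'v) set \<Rightarrow> bool" where
  "is_bipartite_graph V E P \<longleftrightarrow>
     E \<subseteq> V \<times> V \<and> irrefl E \<and> sym E \<and>
     (\<exists>V0 V1. V = V0 \<union> V1 \<and> V0 \<inter> V1 = {} \<and> P = (V0 \<times> V0) \<union> (V1 \<times> V1)) \<and>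
     (\<forall>u v. (u, v) \<in> E \<longrightarrow> (u, v) \<notin> P)"

definition preserves :: "('v \<Rightarrow> 'v) \<Rightarrow> ('v \<times> 'v) set \<Rightarrow> bool" where
  "preserves f R \<longleftrightarrow> (\<forall>u v. (u, v) \<in> R \<longrightarrow> (f u, f v) \<in> R)"

text \<open>
  Elements of \<^term>\<open>Bij V\<close> are the bijections of \<open>V\<close>, made extensional so that each is
  represented by exactly one HOL function; the operation of \<^term>\<open>BijGroup V\<close> is composition.
\<close>

definition graph_automorphisms :: "'v set \<Rightarrow> ('v \<times> 'v) set \<Rightarrow> ('v \<Rightarrow> 'v) set" where
  "graph_automorphisms V E = {f \<in> Bij V. preserves f E \<and> preserves (inv_into V f) E}"

definition graph_Aut :: "'v set \<Rightarrow> ('v \<times> 'v) set \<Rightarrow> ('v \<Rightarrow> 'v) monoid" where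
  "graph_Aut V E = (BijGroup V)\<lparr>carrier := graph_automorphisms V E\<rparr>"

definition bipartite_automorphisms ::
    "'v set \<Rightarrow> ('v \<times> 'v) set \<Rightarrow> ('v \<times> 'v) set \<Rightarrow> ('v \<Rightarrow> 'v) set" where
  "bipartite_automorphisms V E P =
     {f \<in> Bij V. preserves f E \<and> preserves (inv_into V f) E \<and>
                 preserves f P \<and> preserves (inv_into V f) P}"

definition bipartite_Aut ::
    "'v set \<Rightarrow> ('v \<times> 'v) set \<Rightarrow> ('v \<times> 'v) set \<Rightarrow> ('v \<Rightarrow> 'v) monoid" where
  "bipartite_Aut V E P = (BijGroup V)\<lparr>carrier := bipartite_automorphisms V E P\<rparr>"

lemma subgroup_relation_automorphisms:
  assumes "R \<subseteq> V \<times> V"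
  shows "subgroup {f \<in> Bij V. preserves f R \<and> preserves (inv_into V f) R} (BijGroup V)"
proof -
  interpret group "BijGroup V" by (rule group_BijGroup)
  have iff: "preserves f R \<and> preserves (inv_into V f) R \<longleftrightarrow>
      (\<forall>u\<in>V. \<forall>v\<in>V. (u, v) \<in> R \<longleftrightarrow> (f u, f v) \<in> R)" if "f \<in> Bij V" for f
  proof -
    have b: "bij_betw f V V" using that by (simp add: Bij_def)
    have l: "inv_into V f (f x) = x" if "x \<in> V" for x
      using b that by (simp add: bij_betw_inv_into_left)
    have r: "f (inv_into V f x) = x" "inv_into V f x \<in> V" if "x \<in> V" for x
      using b that by (auto simp: bij_betw_inv_into_right bij_betw_def inv_into_into)
    show ?thesis
    proof
      assume "preserves f R \<and> preserves (inv_into V f) R"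
      then show "\<forall>u\<in>V. \<forall>v\<in>V. (u, v) \<in> R \<longleftrightarrow> (f u, f v) \<in> R"
        unfolding preserves_def by (metis l)
    next
      assume *: "\<forall>u\<in>V. \<forall>v\<in>V. (u, v) \<in> R \<longleftrightarrow> (f u, f v) \<in> R"
      have "preserves f R" using * assms unfolding preserves_def by blast
      moreover have "preserves (inv_into V f) R" unfolding preserves_def
      proof (intro allI impI)
        fix u v assume uv: "(u, v) \<in> R"
        then have "u \<in> V" "v \<in> V" using assms by auto
        then show "(inv_into V f u, inv_into V f v) \<in> R"
          using * r uv by metis
      qed
      ultimately show "preserves f R \<and> preserves (inv_into V f) R" ..
    qed
  qed
  let ?H = "{f \<in> Bij V. \<forall>u\<in>V. \<forall>v\<in>V. (u, v) \<in> R \<longleftrightarrow> (f u, f v) \<in> R}"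
  have eq: "{f \<in> Bij V. preserves f R \<and> preserves (inv_into V f) R} = ?H"
    using iff by auto
  have m: "f x \<in> V" if "f \<in> Bij V" "x \<in> V" for f x
    using that by (auto simp: Bij_def bij_betw_def)
  have "subgroup ?H (BijGroup V)"
  proof (rule subgroupI)
    show "?H \<subseteq> carrier (BijGroup V)" by (auto simp: BijGroup_def)
    have "(\<lambda>x\<in>V. x) \<in> ?H" by (auto simp: id_Bij)
    then show "?H \<noteq> {}" by blast
  next
    fix f assume f: "f \<in> ?H"
    have b: "bij_betw f V V" using f by (simp add: Bij_def)
    have r: "f (inv_into V f x) = x" "inv_into V f x \<in> V" if "x \<in> V" for x
      using b that by (auto simp: bij_betw_inv_into_right bij_betw_def inv_into_into)
    show "inv\<^bsub>BijGroup V\<^esub> f \<in> ?H"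
      using f r by (auto simp: inv_BijGroup restrict_inv_into_Bij)
  next
    fix f g assume "f \<in> ?H" "g \<in> ?H"
    then show "f \<otimes>\<^bsub>BijGroup V\<^esub> g \<in> ?H"
      by (auto simp: BijGroup_def compose_Bij compose_eq m)
  qed
  then show ?thesis by (simp only: eq)
qed

lemma group_graph_Aut:
  assumes "is_graph V E"
  shows "group (graph_Aut V E)"
  unfolding graph_Aut_def graph_automorphisms_def
  using subgroup_relation_automorphisms[of E V] assms
  by (intro group.subgroup_imp_group group_BijGroup) (simp add: is_graph_def)

lemma group_bipartite_Aut:
  assumes "is_bipartite_graph V E P"
  shows "group (bipartite_Aut V E P)"
proof -
  have "E \<subseteq> V \<times> V" "P \<subseteq> V \<times> V"
    using assms by (auto simp: is_bipartite_graph_def)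
  then have "subgroup ({f \<in> Bij V. preserves f E \<and> preserves (inv_into V f) E} \<inter>
      {f \<in> Bij V. preserves f P \<and> preserves (inv_into V f) P}) (BijGroup V)"
    by (intro group.subgroups_Inter_pair group_BijGroup subgroup_relation_automorphisms)
  moreover have "{f \<in> Bij V. preserves f E \<and> preserves (inv_into V f) E} \<inter>
      {f \<in> Bij V. preserves f P \<and> preserves (inv_into V f) P} = bipartite_automorphisms V E P"
    by (auto simp: bipartite_automorphisms_def)
  ultimately show ?thesis
    unfolding bipartite_Aut_def by (simp add: group.subgroup_imp_group group_BijGroup)
qed

end

theory Submission
  imports Defs
begin

text \<open>
  A graph becomes bipartite by taking as second part the empty set, the singletons and the edges,
  with membership as adjacency. The empty set is then the only isolated vertex, so no automorphism
  exchanges the parts; an automorphism acts on the second part by taking images of sets, hence it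
  is induced by a permutation of the vertices that maps edges to edges.

  Conversely, a bipartite graph with two nonempty parts becomes a graph by adding a triangle, two
  of whose vertices are joined to one part each. This is the only triangle, and its third vertex
  is the only one with all its neighbours in it, so an automorphism fixes the third
  vertex and permutes the other two, which means that it preserves the partition. If a part is
  empty, there are no edges and the partition imposes no condition.
\<close>

section \<open>Automorphism groups of relational structures\<close>

text \<open>A set of relations covers graphs (\<open>{E}\<close>) and bipartite graphs
  (\<open>{E, P}\<close>) at once. The two-sided condition on points of \<open>V\<close> replaces
  the separate conditions on \<open>f\<close> and its inverse.\<close>

definition rel_automorphisms :: "'a set \<Rightarrow> ('a \<times> 'a) set set \<Rightarrow> ('a \<Rightarrow> 'a) set" where
  "rel_automorphisms V Rs =
     {f \<in> Bij V. \<forall>R\<in>Rs. \<forall>u\<in>V. \<forall>v\<in>V. (u, v) \<in> R \<longleftrightarrow> (f u, f v) \<in> R}"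

definition rel_Aut :: "'a set \<Rightarrow> ('a \<times> 'a) set set \<Rightarrow> ('a \<Rightarrow> 'a) monoid" where
  "rel_Aut V Rs = (BijGroup V)\<lparr>carrier := rel_automorphisms V Rs\<rparr>"

lemma Bij_mem: "f \<in> Bij V \<Longrightarrow> x \<in> V \<Longrightarrow> f x \<in> V"
  by (auto simp: Bij_def bij_betw_def)

lemma Bij_eq_iff: "f \<in> Bij V \<Longrightarrow> x \<in> V \<Longrightarrow> y \<in> V \<Longrightarrow> f x = f y \<longleftrightarrow> x = y"
  by (auto simp: Bij_def bij_betw_def inj_on_def)

lemma Bij_surj: "f \<in> Bij V \<Longrightarrow> y \<in> V \<Longrightarrow> \<exists>x\<in>V. y = f x"
  by (auto simp: Bij_def bij_betw_def)

lemma BijI: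
  assumes "f \<in> extensional V" "inj_on f V" "f ` V = V"
  shows "f \<in> Bij V"
  using assms by (auto simp: Bij_def bij_betw_def)

lemma rel_automorphisms_iff:
  assumes "f \<in> rel_automorphisms V Rs" "R \<in> Rs" "u \<in> V" "v \<in> V"
  shows "(f u, f v) \<in> R \<longleftrightarrow> (u, v) \<in> R"
  using assms by (auto simp: rel_automorphisms_def)

text \<open>Since \<open>R\<close> lies in \<open>V \<times> V\<close>, the unbounded quantifiers of
  \<open>preserves\<close> only concern points of \<open>V\<close>, where \<open>f\<close> and
  \<open>inv_into V f\<close> cancel each other.\<close>

lemma preserves_both_iff:
  assumes f: "f \<in> Bij V" and R: "R \<subseteq> V \<times> V"
  shows "preserves f R \<and> preserves (inv_into V f) R \<longleftrightarrow>
    (\<forall>u\<in>V. \<forall>v\<in>V. (u, v) \<in> R \<longleftrightarrow> (f u, f v) \<in> R)"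
proof -
  have b: "bij_betw f V V" using f by (simp add: Bij_def)
  have l: "inv_into V f (f x) = x" if "x \<in> V" for x
    using b that by (simp add: bij_betw_inv_into_left)
  have r: "f (inv_into V f x) = x" "inv_into V f x \<in> V" if "x \<in> V" for x
    using b that by (auto simp: bij_betw_inv_into_right bij_betw_def inv_into_into)
  show ?thesis
  proof
    assume "preserves f R \<and> preserves (inv_into V f) R"
    then show "\<forall>u\<in>V. \<forall>v\<in>V. (u, v) \<in> R \<longleftrightarrow> (f u, f v) \<in> R"
      unfolding preserves_def by (metis l)
  next
    assume *: "\<forall>u\<in>V. \<forall>v\<in>V. (u, v) \<in> R \<longleftrightarrow> (f u, f v) \<in> R"
    have "(inv_into V f u, inv_into V f v) \<in> R" if "(u, v) \<in> R" for u v
      using that * r R by (metis mem_Sigma_iff subsetD)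
    then show "preserves f R \<and> preserves (inv_into V f) R"
      using * R unfolding preserves_def by blast
  qed
qed

lemma graph_Aut_eq_rel_Aut:
  assumes "is_graph V E"
  shows "graph_Aut V E = rel_Aut V {E}"
proof -
  have "graph_automorphisms V E = rel_automorphisms V {E}"
    unfolding graph_automorphisms_def rel_automorphisms_def
    using assms preserves_both_iff[of _ V E] by (auto simp: is_graph_def)
  then show ?thesis by (simp add: graph_Aut_def rel_Aut_def)
qed

lemma bipartite_Aut_eq_rel_Aut:
  assumes "is_bipartite_graph V E P"
  shows "bipartite_Aut V E P = rel_Aut V {E, P}"
proof -
  have sub: "E \<subseteq> V \<times> V" "P \<subseteq> V \<times> V" using assms by (auto simp: is_bipartite_graph_def)
  have "f \<in> bipartite_automorphisms V E P \<longleftrightarrow> f \<in> rel_automorphisms V {E, P}" for f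
    unfolding bipartite_automorphisms_def rel_automorphisms_def
    using preserves_both_iff[OF _ sub(1), of f] preserves_both_iff[OF _ sub(2), of f] by simp metis
  then have "bipartite_automorphisms V E P = rel_automorphisms V {E, P}" by blast
  then show ?thesis by (simp add: bipartite_Aut_def rel_Aut_def)
qed

text \<open>The common frame for all isomorphisms below: automorphisms of the large structure on
  \<open>W\<close> are restricted to an embedded copy of \<open>V\<close>. By \<open>stable\<close>
  the restriction is a permutation, by \<open>restr\<close> it is an automorphism;
  \<open>ext\<close> makes the restriction map surjective and \<open>uniq\<close> makes it
  injective.\<close>

lemma rel_Aut_iso_restriction:
  fixes \<iota> :: "'a \<Rightarrow> 'b"
  assumes inj: "inj_on \<iota> V" and sub: "\<iota> ` V \<subseteq> W"
    and stable: "\<And>F x. F \<in> rel_automorphisms W Ss \<Longrightarrow> x \<in> W \<Longrightarrow> F x \<in> \<iota> ` V \<longleftrightarrow> x \<in> \<iota> ` V"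
    and restr: "\<And>F f. F \<in> rel_automorphisms W Ss \<Longrightarrow> f \<in> Bij V \<Longrightarrow>
      \<forall>v\<in>V. F (\<iota> v) = \<iota> (f v) \<Longrightarrow> f \<in> rel_automorphisms V Rs"
    and ext: "\<And>f. f \<in> rel_automorphisms V Rs \<Longrightarrow>
      \<exists>F\<in>rel_automorphisms W Ss. \<forall>v\<in>V. F (\<iota> v) = \<iota> (f v)"
    and uniq: "\<And>F F' x. F \<in> rel_automorphisms W Ss \<Longrightarrow> F' \<in> rel_automorphisms W Ss \<Longrightarrow>
      \<forall>v\<in>V. F (\<iota> v) = F' (\<iota> v) \<Longrightarrow> x \<in> W \<Longrightarrow> F x = F' x"
  shows "rel_Aut W Ss \<cong> rel_Aut V Rs"
proof -
  \<comment> \<open>\<open>F\<close> pulled back along \<open>\<iota>\<close>, made extensional so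
    that it can lie in \<open>Bij V\<close>.\<close>
  define \<phi> where "\<phi> F = (\<lambda>v\<in>V. inv_into V \<iota> (F (\<iota> v)))" for F
  have key: "\<iota> (\<phi> F v) = F (\<iota> v)" "\<phi> F v \<in> V"
    if "F \<in> rel_automorphisms W Ss" "v \<in> V" for F v
  proof -
    have "F (\<iota> v) \<in> \<iota> ` V" using that stable sub by blast
    then show "\<iota> (\<phi> F v) = F (\<iota> v)" "\<phi> F v \<in> V"
      using that by (auto simp: \<phi>_def f_inv_into_f inv_into_into)
  qed
  have Bij: "F \<in> Bij W" if "F \<in> rel_automorphisms W Ss" for F
    using that by (simp add: rel_automorphisms_def)
  have \<phi>_in: "\<phi> F \<in> rel_automorphisms V Rs" if F: "F \<in> rel_automorphisms W Ss" for F
  proof -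
    have "\<phi> F \<in> Bij V"
    proof (rule BijI)
      show "\<phi> F \<in> extensional V" by (simp add: \<phi>_def)
      show "inj_on (\<phi> F) V"
      proof (rule inj_onI)
        fix u v assume uv: "u \<in> V" "v \<in> V" "\<phi> F u = \<phi> F v"
        then have "F (\<iota> u) = F (\<iota> v)" using key(1)[OF F] by metis
        then show "u = v" using uv Bij_eq_iff[OF Bij[OF F]] sub inj
          by (metis image_subset_iff inj_onD)
      qed
      have "v \<in> \<phi> F ` V" if v: "v \<in> V" for v
      proof -
        obtain x where x: "x \<in> W" "\<iota> v = F x"
          using Bij_surj[OF Bij[OF F]] sub v by (metis image_subset_iff)
        \<comment> \<open>Here \<open>stable\<close> is used backwards: a point that
          \<open>F\<close> sends into the copy of \<open>V\<close> already lies in the copy. For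
          infinite \<open>V\<close> the forward direction alone would not give surjectivity.\<close>
        then obtain u where "u \<in> V" "x = \<iota> u" using stable[OF F, of x] v by force
        then have "v = \<phi> F u" using x key[OF F] inj v by (metis inj_onD)
        then show ?thesis using \<open>u \<in> V\<close> by blast
      qed
      then show "\<phi> F ` V = V" using key(2)[OF F] by blast
    qed
    then show ?thesis using restr F key by metis
  qed
  have "\<phi> \<in> hom (rel_Aut W Ss) (rel_Aut V Rs)"
  proof (rule homI)
    fix F assume "F \<in> carrier (rel_Aut W Ss)"
    then show "\<phi> F \<in> carrier (rel_Aut V Rs)" using \<phi>_in by (simp add: rel_Aut_def)
  next
    fix F F' assume "F \<in> carrier (rel_Aut W Ss)" "F' \<in> carrier (rel_Aut W Ss)"
    then have FF: "F \<in> rel_automorphisms W Ss" "F' \<in> rel_automorphisms W Ss"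
      by (auto simp: rel_Aut_def)
    have "\<phi> (compose W F F') = compose V (\<phi> F) (\<phi> F')"
    proof (rule extensionalityI)
      show "\<phi> (compose W F F') \<in> extensional V" by (simp add: \<phi>_def)
      show "compose V (\<phi> F) (\<phi> F') \<in> extensional V" by (rule compose_extensional)
      fix v assume v: "v \<in> V"
      have "compose W F F' (\<iota> v) = F (\<iota> (\<phi> F' v))"
        using v sub key(1)[OF FF(2) v] by (auto simp: compose_eq)
      then have "\<phi> (compose W F F') v = inv_into V \<iota> (F (\<iota> (\<phi> F' v)))"
        using v by (simp add: \<phi>_def)
      also have "\<dots> = compose V (\<phi> F) (\<phi> F') v"
        using v key(2)[OF FF(2) v] by (simp add: compose_eq) (simp add: \<phi>_def)
      finally show "\<phi> (compose W F F') v = compose V (\<phi> F) (\<phi> F') v" .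
    qed
    then show "\<phi> (F \<otimes>\<^bsub>rel_Aut W Ss\<^esub> F') = \<phi> F \<otimes>\<^bsub>rel_Aut V Rs\<^esub> \<phi> F'"
      using FF \<phi>_in by (simp add: rel_Aut_def BijGroup_def rel_automorphisms_def)
  qed
  moreover have "bij_betw \<phi> (rel_automorphisms W Ss) (rel_automorphisms V Rs)"
  proof (rule bij_betw_imageI)
    show "inj_on \<phi> (rel_automorphisms W Ss)"
    proof (rule inj_onI)
      fix F F' assume FF: "F \<in> rel_automorphisms W Ss" "F' \<in> rel_automorphisms W Ss" "\<phi> F = \<phi> F'"
      then have "\<forall>v\<in>V. F (\<iota> v) = F' (\<iota> v)" using key(1) by metis
      then have "\<And>x. x \<in> W \<Longrightarrow> F x = F' x" using uniq FF by blast
      then show "F = F'" using Bij[OF FF(1)] Bij[OF FF(2)]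
        by (intro extensionalityI[of F W F']) (auto simp: Bij_def)
    qed
    have "f \<in> \<phi> ` rel_automorphisms W Ss" if f: "f \<in> rel_automorphisms V Rs" for f
    proof -
      obtain F where F: "F \<in> rel_automorphisms W Ss" "\<forall>v\<in>V. F (\<iota> v) = \<iota> (f v)"
        using ext[OF f] by blast
      have fB: "f \<in> Bij V" using f by (simp add: rel_automorphisms_def)
      have "f = \<phi> F"
      proof (rule extensionalityI)
        show "f \<in> extensional V" using fB by (simp add: Bij_def)
        show "\<phi> F \<in> extensional V" by (simp add: \<phi>_def)
        show "f v = \<phi> F v" if "v \<in> V" for v
          using that F inj Bij_mem[OF fB] by (simp add: \<phi>_def)
      qed
      then show ?thesis using F by blast
    qed
    then show "\<phi> ` rel_automorphisms W Ss = rel_automorphisms V Rs" using \<phi>_in by blast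
  qed
  ultimately have "\<phi> \<in> iso (rel_Aut W Ss) (rel_Aut V Rs)"
    by (simp add: iso_def rel_Aut_def)
  then show ?thesis by (rule is_isoI)
qed

section \<open>Isomorphic copies on a prescribed infinite vertex type\<close>

lemma map_prod_mem_iff:
  assumes "inj_on h V" "R \<subseteq> V \<times> V" "u \<in> V" "v \<in> V"
  shows "(h u, h v) \<in> map_prod h h ` R \<longleftrightarrow> (u, v) \<in> R"
proof
  assume "(h u, h v) \<in> map_prod h h ` R"
  then obtain a b where ab: "(a, b) \<in> R" "h u = h a" "h v = h b" by auto
  then have "u = a" "v = b" using assms by (auto dest: inj_onD)
  then show "(u, v) \<in> R" using ab by simp
qed force

text \<open>Transport of structure, as the case of restriction in which the copy of \<open>V\<close>
  is the whole vertex set, so that stability and uniqueness are trivial.\<close>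

lemma rel_Aut_iso_copy:
  assumes inj: "inj_on h V" and Rs: "\<And>R. R \<in> Rs \<Longrightarrow> R \<subseteq> V \<times> V"
  shows "rel_Aut (h ` V) ((`) (map_prod h h) ` Rs) \<cong> rel_Aut V Rs"
proof (rule rel_Aut_iso_restriction[OF inj subset_refl])
  let ?W = "h ` V" and ?Ss = "(`) (map_prod h h) ` Rs"
  show "F x \<in> h ` V \<longleftrightarrow> x \<in> h ` V" if "F \<in> rel_automorphisms ?W ?Ss" "x \<in> ?W" for F x
    using that Bij_mem[of F ?W x] by (simp add: rel_automorphisms_def)
  show "f \<in> rel_automorphisms V Rs" if F: "F \<in> rel_automorphisms ?W ?Ss" and f: "f \<in> Bij V"
    and eq: "\<forall>v\<in>V. F (h v) = h (f v)" for F f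
  proof -
    have "(u, v) \<in> R \<longleftrightarrow> (f u, f v) \<in> R" if "R \<in> Rs" "u \<in> V" "v \<in> V" for R u v
      using rel_automorphisms_iff[OF F, of "map_prod h h ` R" "h u" "h v"] eq that
        map_prod_mem_iff[OF inj Rs[OF that(1)]] Bij_mem[OF f] by simp
    then show ?thesis using f by (simp add: rel_automorphisms_def)
  qed
  show "\<exists>F\<in>rel_automorphisms ?W ?Ss. \<forall>v\<in>V. F (h v) = h (f v)"
    if f: "f \<in> rel_automorphisms V Rs" for f
  proof -
    have fB: "f \<in> Bij V" using f by (simp add: rel_automorphisms_def)
    \<comment> \<open>The conjugate of \<open>f\<close> by \<open>h\<close>.\<close>
    define F where "F = (\<lambda>x\<in>?W. h (f (inv_into V h x)))"
    have Fh: "F (h v) = h (f v)" if "v \<in> V" for v using that inj by (simp add: F_def)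
    have "F \<in> Bij ?W"
    proof (rule BijI)
      show "F \<in> extensional ?W" by (simp add: F_def)
      show "inj_on F ?W"
        using Fh Bij_eq_iff[OF fB] Bij_mem[OF fB] inj_on_eq_iff[OF inj] by (auto intro!: inj_onI)
      have "F ` ?W = h ` f ` V" using Fh by (force simp: image_iff)
      then show "F ` ?W = ?W" using fB by (simp add: Bij_def bij_betw_def)
    qed
    moreover have "(h u, h v) \<in> map_prod h h ` R \<longleftrightarrow> (F (h u), F (h v)) \<in> map_prod h h ` R"
      if "R \<in> Rs" "u \<in> V" "v \<in> V" for R u v
      using that Fh map_prod_mem_iff[OF inj Rs[OF that(1)]] Bij_mem[OF fB]
        rel_automorphisms_iff[OF f] by simp
    ultimately have "F \<in> rel_automorphisms ?W ?Ss" by (simp add: rel_automorphisms_def)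
    then show ?thesis using Fh by blast
  qed
qed blast

text \<open>The constructions below live on sum types, while the theorem prescribes the vertex
  types. Going through the natural numbers treats finite and countably infinite sets alike.\<close>

lemma countable_inj_on_infinite_type:
  assumes "countable A" "infinite (UNIV :: 'w set)"
  shows "\<exists>h :: 'a \<Rightarrow> 'w. inj_on h A"
proof -
  obtain g :: "nat \<Rightarrow> 'w" where "inj g" using assms(2) infinite_countable_subset by blast
  then have "inj_on (g \<circ> to_nat_on A) A"
    using assms(1) by (intro comp_inj_on) (auto intro: inj_on_subset)
  then show ?thesis by blast
qed

lemma is_graph_copy:
  assumes "inj_on h V" "is_graph V E"
  shows "is_graph (h ` V) (map_prod h h ` E)"
proof -
  have E: "E \<subseteq> V \<times> V" "irrefl E" "sym E" using assms by (auto simp: is_graph_def)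
  have "(x, x) \<notin> map_prod h h ` E" for x
  proof
    assume "(x, x) \<in> map_prod h h ` E"
    then obtain u v where uv: "(u, v) \<in> E" "h u = h v" by auto
    then have "u = v" using assms(1) E(1) by (auto dest: inj_onD)
    then show False using uv E(2) by (simp add: irrefl_def)
  qed
  then have "irrefl (map_prod h h ` E)" by (simp add: irrefl_def)
  moreover have "sym (map_prod h h ` E)" using E(3) by (force simp: sym_def)
  ultimately show ?thesis using E(1) by (auto simp: is_graph_def)
qed

lemma is_bipartite_graph_copy:
  assumes inj: "inj_on h V" and bip: "is_bipartite_graph V E P"
  shows "is_bipartite_graph (h ` V) (map_prod h h ` E) (map_prod h h ` P)"
proof -
  obtain V0 V1 where V: "V = V0 \<union> V1" "V0 \<inter> V1 = {}" "P = (V0 \<times> V0) \<union> (V1 \<times> V1)"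
    using bip by (auto simp: is_bipartite_graph_def)
  have "is_graph (h ` V) (map_prod h h ` E)"
    using inj bip by (intro is_graph_copy) (auto simp: is_bipartite_graph_def is_graph_def)
  moreover have "h ` V0 \<inter> h ` V1 = {}" using inj V by (auto simp: inj_on_def)
  moreover have "map_prod h h ` P = (h ` V0 \<times> h ` V0) \<union> (h ` V1 \<times> h ` V1)"
    using V by (auto simp: image_Un map_prod_surj_on)
  moreover have "(x, y) \<notin> map_prod h h ` P" if xy: "(x, y) \<in> map_prod h h ` E" for x y
  proof -
    obtain u v where uv: "(u, v) \<in> E" "x = h u" "y = h v" using xy by auto
    have "u \<in> V" "v \<in> V" "(u, v) \<notin> P" "P \<subseteq> V \<times> V"
      using uv bip V by (auto simp: is_bipartite_graph_def)
    then show ?thesis using map_prod_mem_iff[OF inj, of P u v] uv(2,3) by simp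
  qed
  ultimately show ?thesis
    unfolding is_bipartite_graph_def is_graph_def using V(1) by (metis image_Un)
qed

lemma graph_on_infinite_type:
  fixes V :: "'a set"
  assumes "countable V" "is_graph V E" "infinite (UNIV :: 'w set)"
  shows "\<exists>(V' :: 'w set) E'. countable V' \<and> is_graph V' E' \<and> graph_Aut V' E' \<cong> graph_Aut V E"
proof -
  obtain h :: "'a \<Rightarrow> 'w" where h: "inj_on h V"
    using countable_inj_on_infinite_type assms by blast
  have "is_graph (h ` V) (map_prod h h ` E)" using is_graph_copy h assms by blast
  moreover have "rel_Aut (h ` V) {map_prod h h ` E} \<cong> rel_Aut V {E}"
    using rel_Aut_iso_copy[OF h, of "{E}"] assms by (simp add: is_graph_def)
  ultimately show ?thesis using assms graph_Aut_eq_rel_Aut by (metis countable_image)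
qed

lemma bipartite_graph_on_infinite_type:
  fixes V :: "'a set"
  assumes "countable V" "is_bipartite_graph V E P" "infinite (UNIV :: 'w set)"
  shows "\<exists>(V' :: 'w set) E' P'. countable V' \<and> is_bipartite_graph V' E' P' \<and>
    bipartite_Aut V' E' P' \<cong> bipartite_Aut V E P"
proof -
  obtain h :: "'a \<Rightarrow> 'w" where h: "inj_on h V"
    using countable_inj_on_infinite_type assms by blast
  have "is_bipartite_graph (h ` V) (map_prod h h ` E) (map_prod h h ` P)"
    using is_bipartite_graph_copy h assms by blast
  moreover have "E \<subseteq> V \<times> V" "P \<subseteq> V \<times> V" using assms by (auto simp: is_bipartite_graph_def)
  then have "rel_Aut (h ` V) {map_prod h h ` E, map_prod h h ` P} \<cong> rel_Aut V {E, P}"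
    using rel_Aut_iso_copy[OF h, of "{E, P}"] by auto
  ultimately show ?thesis using assms bipartite_Aut_eq_rel_Aut by (metis countable_image)
qed


section \<open>The incidence graph of a graph\<close>

text \<open>The case \<open>u = v\<close> contributes the singletons. They give every vertex of
  \<open>V\<close> a neighbour, even one that is isolated in the original graph, so that the empty
  set can serve as the marker of its part.\<close>

definition small_subsets :: "'v set \<Rightarrow> ('v \<times> 'v) set \<Rightarrow> 'v set set" where
  "small_subsets V E = insert {} {{u, v} | u v. u \<in> V \<and> v \<in> V \<and> (u = v \<or> (u, v) \<in> E)}"

definition incidence_vertices :: "'v set \<Rightarrow> ('v \<times> 'v) set \<Rightarrow> ('v + 'v set) set" where
  "incidence_vertices V E = Inl ` V \<union> Inr ` small_subsets V E"

definition incidence_edges ::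
    "'v set \<Rightarrow> ('v \<times> 'v) set \<Rightarrow> (('v + 'v set) \<times> ('v + 'v set)) set" where
  "incidence_edges V E =
     {(Inl v, Inr s) | v s. s \<in> small_subsets V E \<and> v \<in> s} \<union>
     {(Inr s, Inl v) | v s. s \<in> small_subsets V E \<and> v \<in> s}"

definition incidence_parts ::
    "'v set \<Rightarrow> ('v \<times> 'v) set \<Rightarrow> (('v + 'v set) \<times> ('v + 'v set)) set" where
  "incidence_parts V E =
     (Inl ` V \<times> Inl ` V) \<union> (Inr ` small_subsets V E \<times> Inr ` small_subsets V E)"

lemma incidence_edges_iff:
  "(Inl v, Inr s) \<in> incidence_edges V E \<longleftrightarrow> s \<in> small_subsets V E \<and> v \<in> s"
  "(Inr s, Inl v) \<in> incidence_edges V E \<longleftrightarrow> s \<in> small_subsets V E \<and> v \<in> s"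
  "(Inl u, Inl v) \<notin> incidence_edges V E"
  "(Inr s, Inr t) \<notin> incidence_edges V E"
  by (auto simp: incidence_edges_def)

lemma small_subsets_subset: "s \<in> small_subsets V E \<Longrightarrow> s \<subseteq> V"
  by (auto simp: small_subsets_def)

text \<open>Edges can be read off from the sets: symmetry of \<open>E\<close> lets an unordered pair
  stand for an edge, and \<open>u \<noteq> v\<close> rules out the singletons.\<close>

lemma pair_mem_small_subsets_iff:
  assumes "is_graph V E" "u \<in> V" "v \<in> V" "u \<noteq> v"
  shows "{u, v} \<in> small_subsets V E \<longleftrightarrow> (u, v) \<in> E"
  using assms unfolding small_subsets_def is_graph_def
  by (auto simp: doubleton_eq_iff dest: symD)

lemma countable_incidence_vertices:
  assumes "countable V"
  shows "countable (incidence_vertices V E)"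
proof -
  have "small_subsets V E \<subseteq> insert {} ((\<lambda>(u, v). {u, v}) ` (V \<times> V))"
    by (auto simp: small_subsets_def)
  then have "countable (small_subsets V E)"
    using assms by (auto intro!: countable_subset[of "small_subsets V E"])
  then show ?thesis using assms by (simp add: incidence_vertices_def)
qed

lemma is_bipartite_graph_incidence:
  "is_bipartite_graph (incidence_vertices V E) (incidence_edges V E) (incidence_parts V E)"
proof -
  have "incidence_edges V E \<subseteq> incidence_vertices V E \<times> incidence_vertices V E"
    by (auto simp: incidence_edges_def incidence_vertices_def dest: small_subsets_subset)
  moreover have "irrefl (incidence_edges V E)" "sym (incidence_edges V E)"
    "\<forall>x y. (x, y) \<in> incidence_edges V E \<longrightarrow> (x, y) \<notin> incidence_parts V E"
    by (auto simp: incidence_edges_def incidence_parts_def irrefl_def sym_def)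
  moreover have "Inl ` V \<inter> Inr ` small_subsets V E = {}" by auto
  ultimately show ?thesis
    unfolding is_bipartite_graph_def incidence_vertices_def incidence_parts_def by blast
qed

text \<open>Lets a graph automorphism act on the second part by images. The backward direction,
  needed for surjectivity of this action, pulls the two endpoints back through \<open>f\<close> and
  then uses that taking images is injective on subsets of \<open>V\<close>.\<close>

lemma image_mem_small_subsets_iff:
  assumes f: "f \<in> rel_automorphisms V {E}" and s: "s \<subseteq> V"
  shows "f ` s \<in> small_subsets V E \<longleftrightarrow> s \<in> small_subsets V E"
proof -
  have fB: "f \<in> Bij V" using f by (simp add: rel_automorphisms_def)
  have E: "(f u, f v) \<in> E \<longleftrightarrow> (u, v) \<in> E" if "u \<in> V" "v \<in> V" for u v
    using rel_automorphisms_iff[OF f] that by simp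
  have inj: "inj_on f V" using fB by (simp add: Bij_def bij_betw_def)
  show ?thesis
  proof
    assume "s \<in> small_subsets V E"
    then consider "s = {}" | u v where "s = {u, v}" "u \<in> V" "v \<in> V" "u = v \<or> (u, v) \<in> E"
      by (auto simp: small_subsets_def)
    then show "f ` s \<in> small_subsets V E"
    proof cases
      case 1
      then show ?thesis by (simp add: small_subsets_def)
    next
      case 2
      then have "f ` s = {f u, f v}" "f u \<in> V" "f v \<in> V" "f u = f v \<or> (f u, f v) \<in> E"
        using E Bij_mem[OF fB] by auto
      then show ?thesis unfolding small_subsets_def by blast
    qed
  next
    assume "f ` s \<in> small_subsets V E"
    then consider "f ` s = {}" | u v where "f ` s = {u, v}" "u \<in> V" "v \<in> V" "u = v \<or> (u, v) \<in> E"
      by (auto simp: small_subsets_def)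
    then show "s \<in> small_subsets V E"
    proof cases
      case 1
      then show ?thesis by (simp add: small_subsets_def)
    next
      case 2
      obtain u' v' where uv: "u' \<in> V" "v' \<in> V" "u = f u'" "v = f v'"
        using 2 Bij_surj[OF fB] by metis
      then have "f ` s = f ` {u', v'}" using 2 by simp
      then have "s = {u', v'}" using inj_on_image_eq_iff[OF inj s, of "{u', v'}"] uv by simp
      moreover have "u' = v' \<or> (u', v') \<in> E" using 2 uv E Bij_eq_iff[OF fB] by blast
      ultimately show ?thesis using uv by (auto simp: small_subsets_def)
    qed
  qed
qed

text \<open>The action on \<open>V\<close> determines the action on the sets, because a set vertex
  is determined by its neighbours. This description serves the stability, restriction and uniqueness
  conditions of \<open>rel_Aut_iso_restriction\<close>.\<close>

lemma incidence_automorphism: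
  assumes F: "F \<in> rel_automorphisms (incidence_vertices V E) {incidence_edges V E, incidence_parts V E}"
  shows "\<exists>f. (\<forall>v\<in>V. F (Inl v) = Inl (f v) \<and> f v \<in> V) \<and>
    (\<forall>s\<in>small_subsets V E. F (Inr s) = Inr (f ` s) \<and> f ` s \<in> small_subsets V E)"
proof -
  let ?W = "incidence_vertices V E" and ?A = "incidence_edges V E" and ?P = "incidence_parts V E"
  have FB: "F \<in> Bij ?W" using F by (simp add: rel_automorphisms_def)
  have A: "(F x, F y) \<in> ?A \<longleftrightarrow> (x, y) \<in> ?A" if "x \<in> ?W" "y \<in> ?W" for x y
    using rel_automorphisms_iff[OF F] that by simp
  have P: "(F x, F y) \<in> ?P \<longleftrightarrow> (x, y) \<in> ?P" if "x \<in> ?W" "y \<in> ?W" for x y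
    using rel_automorphisms_iff[OF F] that by simp
  have empty: "Inr {} \<in> ?W" by (auto simp: incidence_vertices_def small_subsets_def)
  have sing: "{v} \<in> small_subsets V E" if "v \<in> V" for v
    using that by (auto simp: small_subsets_def)
  \<comment> \<open>A vertex \<open>Inl v\<close> is adjacent to \<open>Inr {v}\<close>, and a
    nonempty set is adjacent to its elements.\<close>
  have isolated: "x = Inr {}" if x: "x \<in> ?W" and iso: "\<forall>y\<in>?W. (x, y) \<notin> ?A" for x
  proof (cases x)
    case (Inl v)
    then have "v \<in> V" using x by (auto simp: incidence_vertices_def)
    then have "(x, Inr {v}) \<in> ?A" "Inr {v} \<in> ?W"
      using Inl sing by (auto simp: incidence_edges_def incidence_vertices_def)
    then show ?thesis using iso by blast
  next
    case (Inr s)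
    have s: "s \<in> small_subsets V E" using x Inr by (auto simp: incidence_vertices_def)
    have "v \<notin> s" for v
    proof
      assume "v \<in> s"
      then have "(x, Inl v) \<in> ?A" "Inl v \<in> ?W"
        using Inr s small_subsets_subset[OF s]
        by (auto simp: incidence_edges_def incidence_vertices_def)
      then show False using iso by blast
    qed
    then show ?thesis using Inr by auto
  qed
  have Fe: "F (Inr {}) = Inr {}"
  proof (rule isolated)
    show "F (Inr {}) \<in> ?W" using Bij_mem[OF FB empty] .
    show "\<forall>y\<in>?W. (F (Inr {}), y) \<notin> ?A"
    proof
      fix y assume "y \<in> ?W"
      \<comment> \<open>Every potential neighbour is an image under \<open>F\<close>, so an edge at
        \<open>F (Inr {})\<close> would pull back to an edge at \<open>Inr {}\<close>.\<close>
      then obtain x where "x \<in> ?W" "y = F x" using Bij_surj[OF FB] by blast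
      then show "(F (Inr {}), y) \<notin> ?A" using A empty by (auto simp: incidence_edges_def)
    qed
  qed
  \<comment> \<open>Being \<open>P\<close>-related to the fixed marker characterizes the second
    part, which is therefore invariant.\<close>
  have side: "(x, Inr {}) \<in> ?P \<longleftrightarrow> x \<in> Inr ` small_subsets V E" for x
    by (auto simp: incidence_parts_def small_subsets_def)
  have Fside: "F x \<in> Inr ` small_subsets V E \<longleftrightarrow> x \<in> Inr ` small_subsets V E" if "x \<in> ?W" for x
    using P[OF that empty] side Fe by simp
  define f where "f v = projl (F (Inl v))" for v
  have fV: "F (Inl v) = Inl (f v) \<and> f v \<in> V" if "v \<in> V" for v
  proof -
    have "Inl v \<in> ?W" using that by (simp add: incidence_vertices_def)
    then have "F (Inl v) \<in> Inl ` V"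
      using Bij_mem[OF FB, of "Inl v"] Fside[of "Inl v"] unfolding incidence_vertices_def by blast
    then show ?thesis by (auto simp: f_def)
  qed
  have "F (Inr s) = Inr (f ` s) \<and> f ` s \<in> small_subsets V E" if s: "s \<in> small_subsets V E" for s
  proof -
    have sW: "Inr s \<in> ?W" using s by (simp add: incidence_vertices_def)
    obtain t where t: "F (Inr s) = Inr t" "t \<in> small_subsets V E" using Fside[OF sW] s by blast
    have mem: "f v \<in> t \<longleftrightarrow> v \<in> s" if "v \<in> V" for v
    proof -
      have "Inl v \<in> ?W" using that by (simp add: incidence_vertices_def)
      then show ?thesis using A[of "Inl v" "Inr s"] sW fV[OF that] t s
        by (auto simp: incidence_edges_def)
    qed
    \<comment> \<open>The equivalence \<open>mem\<close> only speaks of points of the form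
      \<open>f v\<close>. That every element of \<open>t\<close> has this form follows from
      surjectivity of \<open>F\<close> and invariance of the parts.\<close>
    have "u \<in> f ` s" if "u \<in> t" for u
    proof -
      have uV: "u \<in> V" using that t small_subsets_subset by blast
      then have "Inl u \<in> ?W" by (simp add: incidence_vertices_def)
      then obtain x where x: "x \<in> ?W" "Inl u = F x" using Bij_surj[OF FB] by blast
      then have "x \<notin> Inr ` small_subsets V E" using Fside[of x] by (metis imageE Inl_Inr_False)
      then obtain v where "v \<in> V" "x = Inl v" using x by (auto simp: incidence_vertices_def)
      then show ?thesis using x fV mem that by auto
    qed
    then have "t = f ` s" using mem small_subsets_subset[OF s] by blast
    then show ?thesis using t by simp
  qed
  then show ?thesis using fV by blast
qed

lemma rel_Aut_incidence_iso:
  assumes G: "is_graph V E"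
  shows "rel_Aut (incidence_vertices V E) {incidence_edges V E, incidence_parts V E} \<cong> rel_Aut V {E}"
    (is "rel_Aut ?W {?A, ?P} \<cong> _")
proof (rule rel_Aut_iso_restriction[where \<iota> = Inl])
  let ?S = "small_subsets V E"
  show "inj_on Inl V" by simp
  show "Inl ` V \<subseteq> ?W" by (simp add: incidence_vertices_def)
  show "F x \<in> Inl ` V \<longleftrightarrow> x \<in> Inl ` V" if F: "F \<in> rel_automorphisms ?W {?A, ?P}" and x: "x \<in> ?W" for F x
    using incidence_automorphism[OF F] x unfolding incidence_vertices_def by fastforce
  show "F x = F' x" if F: "F \<in> rel_automorphisms ?W {?A, ?P}" and F': "F' \<in> rel_automorphisms ?W {?A, ?P}"
    and eq: "\<forall>v\<in>V. F (Inl v) = F' (Inl v)" and x: "x \<in> ?W" for F F' x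
  proof -
    obtain f where f: "\<forall>v\<in>V. F (Inl v) = Inl (f v)" "\<forall>s\<in>?S. F (Inr s) = Inr (f ` s)"
      using incidence_automorphism[OF F] by blast
    obtain f' where f': "\<forall>v\<in>V. F' (Inl v) = Inl (f' v)" "\<forall>s\<in>?S. F' (Inr s) = Inr (f' ` s)"
      using incidence_automorphism[OF F'] by blast
    have "f v = f' v" if "v \<in> V" for v using that f f' eq by auto
    then have "f ` s = f' ` s" if "s \<in> ?S" for s
      using small_subsets_subset[OF that] by (intro image_cong) auto
    then show ?thesis using x eq f f' by (auto simp: incidence_vertices_def)
  qed
  show "f \<in> rel_automorphisms V {E}" if F: "F \<in> rel_automorphisms ?W {?A, ?P}" and f: "f \<in> Bij V"
    and eq: "\<forall>v\<in>V. F (Inl v) = Inl (f v)" for F f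
  proof -
    have FB: "F \<in> Bij ?W" using F by (simp add: rel_automorphisms_def)
    obtain g where g: "\<forall>v\<in>V. F (Inl v) = Inl (g v)"
      "\<forall>s\<in>?S. F (Inr s) = Inr (g ` s) \<and> g ` s \<in> ?S"
      using incidence_automorphism[OF F] by blast
    \<comment> \<open>The functions may differ outside \<open>V\<close>, but small subsets lie
      inside \<open>V\<close>, so their images agree.\<close>
    have "g v = f v" if "v \<in> V" for v using that g eq by auto
    then have "g ` s = f ` s" if "s \<in> ?S" for s
      using small_subsets_subset[OF that] by (intro image_cong) auto
    then have fS: "F (Inr s) = Inr (f ` s)" "f ` s \<in> ?S" if "s \<in> ?S" for s
      using that g(2) by auto
    have "(u, v) \<in> E \<longleftrightarrow> (f u, f v) \<in> E" if uv: "u \<in> V" "v \<in> V" for u v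
    \<comment> \<open>The diagonal is treated apart: \<open>{u, u}\<close> is always a small subset
      although \<open>(u, u)\<close> is never an edge.\<close>
    proof (cases "u = v")
      case True
      then show ?thesis using G by (auto simp: is_graph_def irrefl_def)
    next
      case False
      \<comment> \<open>The preimage under \<open>F\<close> of the vertex
        \<open>Inr {f u, f v}\<close> must be a set vertex, since \<open>F\<close> maps the first
        part into itself; injectivity of \<open>f\<close> identifies that set as
        \<open>{u, v}\<close>.\<close>
      have "{u, v} \<in> ?S" if "{f u, f v} \<in> ?S"
      proof -
        have "Inr {f u, f v} \<in> ?W" using that by (simp add: incidence_vertices_def)
        then obtain x where x: "x \<in> ?W" "Inr {f u, f v} = F x" using Bij_surj[OF FB] by blast
        then obtain s where s: "s \<in> ?S" "x = Inr s"
          using eq by (auto simp: incidence_vertices_def)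
        then have "f ` s = f ` {u, v}" using x fS by auto
        then have "s = {u, v}"
          using f uv small_subsets_subset[OF s(1)] inj_on_image_eq_iff[of f V s "{u, v}"]
          by (auto simp: Bij_def bij_betw_def)
        then show ?thesis using s by simp
      qed
      moreover have "{f u, f v} \<in> ?S" if "{u, v} \<in> ?S" using fS(2)[OF that] by simp
      moreover have "f u \<noteq> f v" using False Bij_eq_iff[OF f] uv by simp
      ultimately show ?thesis
        using False uv Bij_mem[OF f] pair_mem_small_subsets_iff[OF G] by metis
    qed
    then show ?thesis using f by (simp add: rel_automorphisms_def)
  qed
  show "\<exists>F\<in>rel_automorphisms ?W {?A, ?P}. \<forall>v\<in>V. F (Inl v) = Inl (f v)"
    if f: "f \<in> rel_automorphisms V {E}" for f
  proof -
    have fB: "f \<in> Bij V" using f by (simp add: rel_automorphisms_def)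
    then have inj: "inj_on f V" and surj: "f ` V = V" by (auto simp: Bij_def bij_betw_def)
    \<comment> \<open>The extension forced by \<open>incidence_automorphism\<close>:
      \<open>f\<close> on vertices, images under \<open>f\<close> on sets.\<close>
    define F where "F = (\<lambda>x\<in>?W. map_sum f ((`) f) x)"
    have Fl: "F (Inl v) = Inl (f v)" if "v \<in> V" for v
      using that by (simp add: F_def incidence_vertices_def)
    have Fr: "F (Inr s) = Inr (f ` s)" if "s \<in> ?S" for s
      using that by (simp add: F_def incidence_vertices_def)
    have S_iff: "f ` s \<in> ?S \<longleftrightarrow> s \<in> ?S" if "s \<subseteq> V" for s
      using image_mem_small_subsets_iff[OF f that] .
    have inj_S: "f ` s = f ` t \<longleftrightarrow> s = t" if "s \<in> ?S" "t \<in> ?S" for s t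
      by (rule inj_on_image_eq_iff[OF inj small_subsets_subset[OF that(1)] small_subsets_subset[OF that(2)]])
    have mem_iff: "f v \<in> f ` s \<longleftrightarrow> v \<in> s" if "v \<in> V" "s \<in> ?S" for v s
      by (rule inj_on_image_mem_iff[OF inj that(1) small_subsets_subset[OF that(2)]])
    have surj_S: "(`) f ` ?S = ?S"
    proof -
      have "t \<in> (`) f ` ?S" if t: "t \<in> ?S" for t
      proof -
        \<comment> \<open>Surjectivity of \<open>f\<close> gives a preimage among all subsets of
          \<open>V\<close>; \<open>S_iff\<close> then shows that it is small.\<close>
        obtain s where "s \<subseteq> V" "t = f ` s"
          using small_subsets_subset[OF t] surj by (metis subset_imageE)
        then show ?thesis using S_iff t by blast
      qed
      then show ?thesis using S_iff small_subsets_subset by (metis image_subset_iff subsetI subset_antisym)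
    qed
    have "F \<in> Bij ?W"
    proof (rule BijI)
      show "F \<in> extensional ?W" by (simp add: F_def)
      show "inj_on F ?W"
        using Fl Fr inj_S Bij_eq_iff[OF fB] by (auto simp: inj_on_def incidence_vertices_def)
      have "F ` ?W = Inl ` f ` V \<union> Inr ` (`) f ` ?S"
        unfolding incidence_vertices_def image_Un image_image using Fl Fr by simp
      then show "F ` ?W = ?W" using surj surj_S by (simp add: incidence_vertices_def)
    qed
    moreover have "(x, y) \<in> ?A \<longleftrightarrow> (F x, F y) \<in> ?A" "(x, y) \<in> ?P \<longleftrightarrow> (F x, F y) \<in> ?P"
      if xy: "x \<in> ?W" "y \<in> ?W" for x y
    proof -
      have S: "f ` s \<in> ?S" if "s \<in> ?S" for s using that surj_S by blast
      show "(x, y) \<in> ?A \<longleftrightarrow> (F x, F y) \<in> ?A"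
        using xy Fl Fr mem_iff S unfolding incidence_vertices_def
        by (elim UnE imageE; simp add: incidence_edges_iff)
      show "(x, y) \<in> ?P \<longleftrightarrow> (F x, F y) \<in> ?P"
        using xy Fl Fr S Bij_mem[OF fB] unfolding incidence_vertices_def
        by (auto simp: incidence_parts_def)
    qed
    ultimately have "F \<in> rel_automorphisms ?W {?A, ?P}" by (simp add: rel_automorphisms_def)
    then show ?thesis using Fl by blast
  qed
qed

section \<open>Marking a bipartition by a triangle\<close>

text \<open>The three elements of \<open>bool option\<close> form the triangle. In
  \<open>triangle_edges\<close> the bipartition is a two-colouring \<open>c\<close>:
  \<open>Some b\<close> is joined to all vertices of colour \<open>b\<close>, and
  \<open>None\<close> to no vertex of \<open>V\<close>.\<close>

definition triangle_vertices :: "'w set \<Rightarrow> ('w + bool option) set" where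
  "triangle_vertices V = Inl ` V \<union> range Inr"

definition triangle_edges ::
    "'w set \<Rightarrow> ('w \<times> 'w) set \<Rightarrow> ('w \<Rightarrow> bool) \<Rightarrow> (('w + bool option) \<times> ('w + bool option)) set" where
  "triangle_edges V E c =
     {(Inl u, Inl v) | u v. (u, v) \<in> E} \<union>
     {(Inl v, Inr (Some (c v))) | v. v \<in> V} \<union>
     {(Inr (Some (c v)), Inl v) | v. v \<in> V} \<union>
     {(Inr a, Inr b) | a b. a \<noteq> b}"

lemma triangle_edges_iff:
  "(Inl u, Inl v) \<in> triangle_edges V E c \<longleftrightarrow> (u, v) \<in> E"
  "(Inl v, Inr a) \<in> triangle_edges V E c \<longleftrightarrow> v \<in> V \<and> a = Some (c v)"
  "(Inr a, Inl v) \<in> triangle_edges V E c \<longleftrightarrow> v \<in> V \<and> a = Some (c v)"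
  "(Inr a, Inr b) \<in> triangle_edges V E c \<longleftrightarrow> a \<noteq> b"
  by (auto simp: triangle_edges_def)

lemma is_graph_triangle:
  assumes "is_graph V E"
  shows "is_graph (triangle_vertices V) (triangle_edges V E c)"
  using assms
  by (auto simp: is_graph_def triangle_edges_def triangle_vertices_def irrefl_def sym_def)

text \<open>Here \<open>\<sigma>\<close> is the permutation of the two colours, that is, the
  identity or the exchange of the parts. Surjectivity of \<open>c\<close> says that both parts are
  nonempty, which distinguishes \<open>None\<close> from the other two triangle vertices.\<close>

lemma triangle_automorphism:
  fixes V :: "'w set" and c :: "'w \<Rightarrow> bool"
  assumes c: "c ` V = UNIV" and E: "\<And>u v. (u, v) \<in> E \<Longrightarrow> c u \<noteq> c v"
    and F: "F \<in> rel_automorphisms (triangle_vertices V) {triangle_edges V E c}"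
  shows "\<exists>f \<sigma>. (\<forall>v\<in>V. F (Inl v) = Inl (f v) \<and> f v \<in> V \<and> c (f v) = \<sigma> (c v)) \<and> inj \<sigma> \<and>
    F (Inr None) = Inr None \<and> (\<forall>b. F (Inr (Some b)) = Inr (Some (\<sigma> b)))"
proof -
  let ?W = "triangle_vertices V" and ?A = "triangle_edges V E c"
  have FB: "F \<in> Bij ?W" using F by (simp add: rel_automorphisms_def)
  have A: "(F x, F y) \<in> ?A \<longleftrightarrow> (x, y) \<in> ?A" if "x \<in> ?W" "y \<in> ?W" for x y
    using rel_automorphisms_iff[OF F] that by simp
  have W: "Inr a \<in> ?W" for a by (simp add: triangle_vertices_def)
  have Wl: "Inl v \<in> ?W \<longleftrightarrow> v \<in> V" for v by (auto simp: triangle_vertices_def)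
  \<comment> \<open>Lying on a triangle is expressed by edges alone, hence invariant under
    \<open>F\<close>.\<close>
  define T where "T x \<longleftrightarrow> (\<exists>y\<in>?W. \<exists>z\<in>?W. (x, y) \<in> ?A \<and> (y, z) \<in> ?A \<and> (z, x) \<in> ?A)" for x
  have T_iff: "T x \<longleftrightarrow> x \<in> range Inr" for x
  proof (cases x)
    case (Inl v)
    have "\<not> T (Inl v)"
    proof
      assume "T (Inl v)"
      then obtain y z where "(Inl v, y) \<in> ?A" "(y, z) \<in> ?A" "(z, Inl v) \<in> ?A"
        by (auto simp: T_def)
      \<comment> \<open>Adjacent vertices of \<open>V\<close> have different colours: three of them
        would need three colours, and two of them share no neighbour in the triangle. A single
        vertex of \<open>V\<close> has only one neighbour in the triangle.\<close>
      then show False by (cases y; cases z) (auto simp: triangle_edges_iff dest: E)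
    qed
    then show ?thesis using Inl by auto
  next
    case (Inr a)
    have "\<exists>b d :: bool option. a \<noteq> b \<and> b \<noteq> d \<and> d \<noteq> a"
    proof (cases a)
      case None
      then show ?thesis by (intro exI[of _ "Some True"] exI[of _ "Some False"]) auto
    next
      case (Some b)
      then show ?thesis by (intro exI[of _ "Some (\<not> b)"] exI[of _ None]) auto
    qed
    then have "T (Inr a)" using W unfolding T_def by (metis triangle_edges_iff(4))
    then show ?thesis using Inr by auto
  qed
  have FT: "F x \<in> range Inr \<longleftrightarrow> x \<in> range Inr" if x: "x \<in> ?W" for x
  proof -
    have "T (F x) \<longleftrightarrow> T x"
    proof
      assume "T x"
      then show "T (F x)" unfolding T_def using A x Bij_mem[OF FB] by meson
    next
      assume "T (F x)"
      then show "T x" unfolding T_def using A x Bij_surj[OF FB] by metis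
    qed
    then show ?thesis using T_iff by simp
  qed
  define f where "f v = projl (F (Inl v))" for v
  have fV: "F (Inl v) = Inl (f v) \<and> f v \<in> V" if "v \<in> V" for v
  proof -
    have "F (Inl v) \<notin> range Inr" "F (Inl v) \<in> ?W"
      using FT[of "Inl v"] Bij_mem[OF FB] Wl that by auto
    then show ?thesis by (auto simp: f_def triangle_vertices_def)
  qed
  define \<tau> where "\<tau> a = projr (F (Inr a))" for a
  have \<tau>: "F (Inr a) = Inr (\<tau> a)" for a using FT[OF W, of a] by (auto simp: \<tau>_def)
  have \<tau>_inj: "\<tau> a = \<tau> b \<longleftrightarrow> a = b" for a b
    using Bij_eq_iff[OF FB W W, of a b] by (simp add: \<tau>)
  have \<tau>c: "\<tau> (Some (c v)) = Some (c (f v))" if "v \<in> V" for v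
  proof -
    have "(Inl v, Inr (Some (c v))) \<in> ?A" using that by (simp add: triangle_edges_iff)
    then have "(Inl (f v), Inr (\<tau> (Some (c v)))) \<in> ?A"
      using A[of "Inl v" "Inr (Some (c v))"] W Wl that fV \<tau> by simp
    then show ?thesis by (simp add: triangle_edges_iff)
  qed
  \<comment> \<open>Some vertex of \<open>V\<close> has colour \<open>b\<close>, so the image of
    \<open>Some b\<close> is again adjacent to a vertex of \<open>V\<close> and cannot be
    \<open>None\<close>.\<close>
  have \<tau>_Some: "\<exists>b'. \<tau> (Some b) = Some b'" for b
  proof -
    obtain v where "v \<in> V" "b = c v" using c by (metis UNIV_I imageE)
    then show ?thesis using \<tau>c by blast
  qed
  define \<sigma> where "\<sigma> b = the (\<tau> (Some b))" for b
  have \<sigma>: "\<tau> (Some b) = Some (\<sigma> b)" for b using \<tau>_Some[of b] by (auto simp: \<sigma>_def)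
  have \<sigma>_inj: "inj \<sigma>"
  proof (rule injI)
    fix a b assume "\<sigma> a = \<sigma> b"
    then have "\<tau> (Some a) = \<tau> (Some b)" by (simp add: \<sigma>)
    then show "a = b" by (simp add: \<tau>_inj)
  qed
  have "\<tau> None = None"
  proof (cases "\<tau> None")
    case (Some b)
    \<comment> \<open>An injective \<open>\<sigma>\<close> on the finite type \<open>bool\<close> is
      surjective, so \<open>\<tau>\<close> already takes every value \<open>Some b\<close> on the
      other two vertices, leaving only \<open>None\<close>.\<close>
    obtain b' where b': "\<sigma> b' = b" using finite_UNIV_inj_surj[OF _ \<sigma>_inj] by (metis finite surjD)
    have "\<tau> (Some b') = \<tau> None" by (simp add: \<sigma> b' Some)
    then show ?thesis by (simp add: \<tau>_inj)
  qed
  then show ?thesis using fV \<tau> \<sigma> \<sigma>_inj \<tau>c by (intro exI[of _ f] exI[of _ \<sigma>]) simp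
qed

text \<open>\<open>P\<close> is the relation of having the same colour. A permutation of
  \<open>V\<close> preserves it in both directions exactly when it induces a permutation of the
  colours, and this is what the action on the triangle records.\<close>

lemma rel_Aut_triangle_iso:
  fixes V :: "'w set" and c :: "'w \<Rightarrow> bool"
  assumes c: "c ` V = UNIV" and E: "\<And>u v. (u, v) \<in> E \<Longrightarrow> c u \<noteq> c v"
    and P: "P = {(u, v). u \<in> V \<and> v \<in> V \<and> c u = c v}"
  shows "rel_Aut (triangle_vertices V) {triangle_edges V E c} \<cong> rel_Aut V {E, P}"
    (is "rel_Aut ?W {?A} \<cong> _")
proof (rule rel_Aut_iso_restriction[where \<iota> = Inl])
  note aut = triangle_automorphism[OF c E]
  show "inj_on Inl V" by simp
  show "Inl ` V \<subseteq> ?W" by (simp add: triangle_vertices_def)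
  have c_obtain: "\<exists>v\<in>V. c v = b" for b using c by (metis UNIV_I imageE)
  show "F x \<in> Inl ` V \<longleftrightarrow> x \<in> Inl ` V" if F: "F \<in> rel_automorphisms ?W {?A}" and x: "x \<in> ?W" for F x
  proof -
    obtain f \<sigma> where f: "\<forall>v\<in>V. F (Inl v) = Inl (f v) \<and> f v \<in> V"
      and F_None: "F (Inr None) = Inr None" and F_Some: "\<forall>b. F (Inr (Some b)) = Inr (Some (\<sigma> b))"
      using aut[OF _ F] by blast
    from f have l: "F (Inl v) \<in> Inl ` V" if "v \<in> V" for v using that by simp
    have r: "F (Inr a) \<notin> Inl ` V" for a using F_None F_Some by (cases a) auto
    show ?thesis using x l r unfolding triangle_vertices_def by blast
  qed
  show "F x = F' x" if F: "F \<in> rel_automorphisms ?W {?A}" and F': "F' \<in> rel_automorphisms ?W {?A}"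
    and eq: "\<forall>v\<in>V. F (Inl v) = F' (Inl v)" and x: "x \<in> ?W" for F F' x
  proof -
    obtain f \<sigma> where f: "\<forall>v\<in>V. F (Inl v) = Inl (f v) \<and> c (f v) = \<sigma> (c v)"
      "F (Inr None) = Inr None" "\<forall>b. F (Inr (Some b)) = Inr (Some (\<sigma> b))"
      using aut[OF _ F] by blast
    obtain f' \<sigma>' where f': "\<forall>v\<in>V. F' (Inl v) = Inl (f' v) \<and> c (f' v) = \<sigma>' (c v)"
      "F' (Inr None) = Inr None" "\<forall>b. F' (Inr (Some b)) = Inr (Some (\<sigma>' b))"
      using aut[OF _ F'] by blast
    \<comment> \<open>Each colour occurs in \<open>V\<close>, so the values on \<open>V\<close>
      determine the colour permutation and with it the action on the triangle.\<close>
    have "\<sigma> b = \<sigma>' b" for b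
    proof -
      obtain v where v: "v \<in> V" "c v = b" using c_obtain by blast
      then have "Inl (f v) = (Inl (f' v) :: 'w + bool option)" using f(1) f'(1) eq by metis
      then show ?thesis using f(1) f'(1) v by auto
    qed
    then have "F (Inr a) = F' (Inr a)" for a using f f' by (cases a) auto
    then show ?thesis using x eq by (auto simp: triangle_vertices_def)
  qed
  show "f \<in> rel_automorphisms V {E, P}" if F: "F \<in> rel_automorphisms ?W {?A}" and f: "f \<in> Bij V"
    and eq: "\<forall>v\<in>V. F (Inl v) = Inl (f v)" for F f
  proof -
    obtain g \<sigma> where g: "\<forall>v\<in>V. F (Inl v) = Inl (g v) \<and> c (g v) = \<sigma> (c v)" "inj \<sigma>"
      using aut[OF _ F] by blast
    have cf: "c (f v) = \<sigma> (c v)" if "v \<in> V" for v using that g(1) eq by auto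
    \<comment> \<open>Injectivity of \<open>\<sigma>\<close> gives the direction from right to
      left.\<close>
    have "(u, v) \<in> P \<longleftrightarrow> (f u, f v) \<in> P" if "u \<in> V" "v \<in> V" for u v
      using that cf g(2) Bij_mem[OF f] by (auto simp: P inj_eq)
    moreover have "(u, v) \<in> E \<longleftrightarrow> (f u, f v) \<in> E" if "u \<in> V" "v \<in> V" for u v
      using that eq rel_automorphisms_iff[OF F, of ?A "Inl u" "Inl v"]
      by (simp add: triangle_edges_iff triangle_vertices_def)
    ultimately show ?thesis using f by (simp add: rel_automorphisms_def)
  qed
  show "\<exists>F\<in>rel_automorphisms ?W {?A}. \<forall>v\<in>V. F (Inl v) = Inl (f v)"
    if f: "f \<in> rel_automorphisms V {E, P}" for f
  proof -
    have fB: "f \<in> Bij V" using f by (simp add: rel_automorphisms_def)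
    have fE: "(f u, f v) \<in> E \<longleftrightarrow> (u, v) \<in> E" if "u \<in> V" "v \<in> V" for u v
      using rel_automorphisms_iff[OF f] that by simp
    have fP: "c (f u) = c (f v) \<longleftrightarrow> c u = c v" if "u \<in> V" "v \<in> V" for u v
      using rel_automorphisms_iff[OF f, of P u v] that Bij_mem[OF fB] by (simp add: P)
    \<comment> \<open>The colour of the image of an arbitrary vertex of colour \<open>b\<close>.
      Preservation of \<open>P\<close> makes it independent of the choice, and surjectivity of
      \<open>c\<close> provides a vertex to choose.\<close>
    define \<sigma> where "\<sigma> b = c (f (SOME v. v \<in> V \<and> c v = b))" for b
    have \<sigma>: "\<sigma> (c v) = c (f v)" if "v \<in> V" for v
    proof -
      let ?u = "SOME u. u \<in> V \<and> c u = c v"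
      have "?u \<in> V \<and> c ?u = c v"
        using someI[of "\<lambda>u. u \<in> V \<and> c u = c v" v] that by blast
      then show ?thesis using fP that by (simp add: \<sigma>_def)
    qed
    have "\<sigma> a = \<sigma> b \<longleftrightarrow> a = b" for a b
    proof -
      obtain u where u: "u \<in> V" "c u = a" using c_obtain[of a] by (elim bexE)
      obtain v where v: "v \<in> V" "c v = b" using c_obtain[of b] by (elim bexE)
      show ?thesis using \<sigma>[OF u(1)] \<sigma>[OF v(1)] fP[OF u(1) v(1)] u(2) v(2) by simp
    qed
    then have "inj \<sigma>" by (simp add: inj_def)
    then have "inj (map_option \<sigma>)" by (rule option.inj_map)
    then have bij: "bij (map_option \<sigma>)" using finite_UNIV_inj_surj[of "map_option \<sigma>"] by (simp add: bij_def)
    define F where "F = (\<lambda>x\<in>?W. map_sum f (map_option \<sigma>) x)"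
    have Fl: "F (Inl v) = Inl (f v)" if "v \<in> V" for v
      using that by (simp add: F_def triangle_vertices_def)
    have Fr: "F (Inr a) = Inr (map_option \<sigma> a)" for a
      by (simp add: F_def triangle_vertices_def)
    have "F \<in> Bij ?W"
    proof (rule BijI)
      show "F \<in> extensional ?W" by (simp add: F_def)
      show "inj_on F ?W"
        using Fl Fr Bij_eq_iff[OF fB] bij_is_inj[OF bij]
        by (auto simp: inj_on_def triangle_vertices_def)
      have "F ` ?W = Inl ` f ` V \<union> Inr ` range (map_option \<sigma>)"
        unfolding triangle_vertices_def image_Un image_image using Fl Fr by simp
      then show "F ` ?W = ?W"
        using fB bij_is_surj[OF bij] by (simp add: triangle_vertices_def Bij_def bij_betw_def)
    qed
    moreover have "(x, y) \<in> ?A \<longleftrightarrow> (F x, F y) \<in> ?A" if xy: "x \<in> ?W" "y \<in> ?W" for x y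
    proof -
      have opt: "map_option \<sigma> a = map_option \<sigma> b \<longleftrightarrow> a = b" for a b
        using bij_is_inj[OF bij] by (simp add: inj_eq)
      have opt_Some: "map_option \<sigma> a = Some (c (f v)) \<longleftrightarrow> a = Some (c v)" if "v \<in> V" for a v
        using opt[of a "Some (c v)"] \<sigma>[OF that] by simp
      show ?thesis
        using xy Fl Fr fE \<sigma> opt opt_Some Bij_mem[OF fB] unfolding triangle_vertices_def
        by (auto simp: triangle_edges_iff)
    qed
    ultimately have "F \<in> rel_automorphisms ?W {?A}" by (simp add: rel_automorphisms_def)
    then show ?thesis using Fl by blast
  qed
qed

section \<open>Realization of each kind of automorphism group by the other kind of structure\<close>

lemma bipartite_Aut_is_graph_Aut:
  fixes V :: "'a set"
  assumes "countable V" and bip: "is_bipartite_graph V E P" and inf: "infinite (UNIV :: 'v set)"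
  shows "\<exists>(V' :: 'v set) E'. countable V' \<and> is_graph V' E' \<and> graph_Aut V' E' \<cong> bipartite_Aut V E P"
proof -
  obtain V0 V1 where V: "V = V0 \<union> V1" "V0 \<inter> V1 = {}" "P = (V0 \<times> V0) \<union> (V1 \<times> V1)"
    and EP: "\<And>u v. (u, v) \<in> E \<Longrightarrow> (u, v) \<notin> P"
    using bip by (auto simp: is_bipartite_graph_def)
  have G: "is_graph V E" using bip by (auto simp: is_bipartite_graph_def is_graph_def)
  show ?thesis
  proof (cases "V0 = {} \<or> V1 = {}")
    case True
    \<comment> \<open>Every permutation of \<open>V\<close> preserves the full relation, so the same
      vertices and edges already give the required graph. The triangle would not do here, as it
      requires both colours to occur.\<close>
    then have "P = V \<times> V" using V by auto
    then have "rel_automorphisms V {E} = rel_automorphisms V {E, P}"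
      by (auto simp: rel_automorphisms_def Bij_mem)
    then have "graph_Aut V E = bipartite_Aut V E P"
      using bip G by (simp add: graph_Aut_eq_rel_Aut bipartite_Aut_eq_rel_Aut rel_Aut_def)
    then show ?thesis using graph_on_infinite_type[OF assms(1) G inf] by simp
  next
    case False
    define c where "c v \<longleftrightarrow> v \<in> V1" for v
    have c: "c ` V = UNIV"
    proof -
      obtain u v where "u \<in> V0" "v \<in> V1" using False by blast
      then have "c u = False" "c v = True" "u \<in> V" "v \<in> V" using V by (auto simp: c_def)
      then show ?thesis unfolding UNIV_bool by (metis (full_types) UNIV_bool UNIV_eq_I imageI)
    qed
    have P: "P = {(u, v). u \<in> V \<and> v \<in> V \<and> c u = c v}" using V by (auto simp: c_def)
    have E: "c u \<noteq> c v" if "(u, v) \<in> E" for u v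
      using EP[OF that] that G P by (auto simp: is_graph_def)
    let ?W = "triangle_vertices V" and ?A = "triangle_edges V E c"
    have gW: "is_graph ?W ?A" using is_graph_triangle[OF G] .
    have "countable ?W" using assms(1) by (simp add: triangle_vertices_def)
    \<comment> \<open>The triangle graph lives on a sum type and is moved to the prescribed
      type.\<close>
    then obtain V' :: "'v set" and E' where V': "countable V'" "is_graph V' E'"
      "graph_Aut V' E' \<cong> graph_Aut ?W ?A"
      using graph_on_infinite_type[OF _ gW inf] by blast
    have "graph_Aut ?W ?A \<cong> bipartite_Aut V E P"
      using rel_Aut_triangle_iso[OF c E P] bip gW
      by (simp add: graph_Aut_eq_rel_Aut bipartite_Aut_eq_rel_Aut)
    then show ?thesis using V' iso_trans by blast
  qed
qed

lemma graph_Aut_is_bipartite_Aut: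
  fixes V :: "'a set"
  assumes "countable V" and G: "is_graph V E" and inf: "infinite (UNIV :: 'w set)"
  shows "\<exists>(V' :: 'w set) E' P'. countable V' \<and> is_bipartite_graph V' E' P' \<and>
    bipartite_Aut V' E' P' \<cong> graph_Aut V E"
proof -
  let ?W = "incidence_vertices V E" and ?A = "incidence_edges V E" and ?P = "incidence_parts V E"
  have bip: "is_bipartite_graph ?W ?A ?P" by (rule is_bipartite_graph_incidence)
  obtain V' :: "'w set" and E' P' where V': "countable V'" "is_bipartite_graph V' E' P'"
    "bipartite_Aut V' E' P' \<cong> bipartite_Aut ?W ?A ?P"
    using bipartite_graph_on_infinite_type[OF countable_incidence_vertices[OF assms(1)] bip inf]
    by blast
  have "bipartite_Aut ?W ?A ?P \<cong> graph_Aut V E"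
    using rel_Aut_incidence_iso[OF G] bip G
    by (simp add: graph_Aut_eq_rel_Aut bipartite_Aut_eq_rel_Aut)
  then show ?thesis using V' iso_trans by blast
qed

theorem theorem5p3:
  fixes G :: "'g monoid"
  assumes "group G"
    and "infinite (UNIV :: 'v set)" and "infinite (UNIV :: 'w set)"
  shows "(\<exists>(V :: 'v set) E. countable V \<and> is_graph V E \<and> G \<cong> graph_Aut V E) \<longleftrightarrow>
         (\<exists>(V :: 'w set) E P. countable V \<and> is_bipartite_graph V E P \<and> G \<cong> bipartite_Aut V E P)"
proof
  assume "\<exists>(V :: 'v set) E. countable V \<and> is_graph V E \<and> G \<cong> graph_Aut V E"
  then obtain V :: "'v set" and E where V: "countable V" "is_graph V E" "G \<cong> graph_Aut V E"
    by blast
  obtain V' :: "'w set" and E' P' where V': "countable V'" "is_bipartite_graph V' E' P'"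
    "bipartite_Aut V' E' P' \<cong> graph_Aut V E"
    using graph_Aut_is_bipartite_Aut[OF V(1,2) assms(3)] by blast
  \<comment> \<open>The isomorphism obtained points away from the new automorphism group. Reversing
    it uses that this automorphism group is a group.\<close>
  then have "G \<cong> bipartite_Aut V' E' P'"
    using V(3) group.iso_sym[OF group_bipartite_Aut[OF V'(2)]] iso_trans by blast
  then show "\<exists>(V :: 'w set) E P. countable V \<and> is_bipartite_graph V E P \<and> G \<cong> bipartite_Aut V E P"
    using V' by blast
next
  assume "\<exists>(V :: 'w set) E P. countable V \<and> is_bipartite_graph V E P \<and> G \<cong> bipartite_Aut V E P"
  then obtain V :: "'w set" and E P where V: "countable V" "is_bipartite_graph V E P"
    "G \<cong> bipartite_Aut V E P" by blast
  obtain V' :: "'v set" and E' where V': "countable V'" "is_graph V' E'"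
    "graph_Aut V' E' \<cong> bipartite_Aut V E P"
    using bipartite_Aut_is_graph_Aut[OF V(1,2) assms(2)] by blast
  then have "G \<cong> graph_Aut V' E'"
    using V(3) group.iso_sym[OF group_graph_Aut[OF V'(2)]] iso_trans by blast
  then show "\<exists>(V :: 'v set) E. countable V \<and> is_graph V E \<and> G \<cong> graph_Aut V E"
    using V' by blast
qed

end
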